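(* Let $R$ be a unital $*$-ring, let $a,w,v\in R$, suppose that $v$ is invertible along $a$, and let $a^-$ be an inner inverse of $a$. Then the following conditions are equivalent: (i) $a$ is both $w$-core invertible and dual $v$-core invertible. (ii) $w$ is invertible along $a$ and $a$ is Moore-Penrose invertible. (iii) $u=awavaa^*+1-aa^{-}\in R^{-1}$. (iv) $r=avawaa^*+1-aa^{-}\in R^{-1}$. (v) $s=wavaa^*a+1-a^{-}a\in R^{-1}$. (vi) $t=vawaa^*a+1-a^{-}a\in R^{-1}$. In this case, the $w$-core inverse of $a$ equals $avaa^*as^{-1}(u^{-1}awava)^*$ and the dual $v$-core inverse of $a$ equals $(u^{-1}awava)^*awaa^*at^{-1}$.
   Context: A unital $*$-ring is an associative ring $R$ with identity $1$ and a map $*$ satisfying $(x^* )^*=x$, $(xy)^*=y^*x^*$ and $(x+y)^*=x^*+y^*$ for all $x,y\in R$. $R^{-1}$ is the group of invertible elements of $R$. For $a,w\in R$, $a$ is $w$-core invertible if there exists $x\in R$ with $awx^2=x$, $xawa=a$ and $(awx)^*=awx$. Such an $x$ is unique if it exists and is called the $w$-core inverse of $a$. For $a,v\in R$, $a$ is dual $v$-core invertible if there exists $y\in R$ with $avay=a$, $y^2va=y$ and $(yva)^*=yva$. Such a $y$ is unique if it exists and is called the dual $v$-core inverse of $a$. For $c,d\in R$, $c$ is invertible along $d$ if there exists $b\in R$ with $bcd=d=dcb$ and $b\in dR\cap Rd$. (If so, $d$ has an inner inverse.) An inner inverse of $a$ is an $x\in R$ with $axa=a$. An element $a$ is Moore-Penrose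 invertible if there is $x\in R$ with $axa=a$, $xax=x$, $(ax)^*=ax$, $(xa)^*=xa$. *)

theory Defs
  imports Main
begin

text \<open>
  The class is built on \<^class>\<open>ring\<close> and \<^class>\<open>monoid_mult\<close> instead of \<^class>\<open>ring_1\<close>
  because the latter assumes that 0 and 1 are distinct, so it excludes the zero ring.
\<close>

class unital_star_ring = ring + monoid_mult +
  fixes star :: "'a \<Rightarrow> 'a"  ("(_\<^sup>\<star>)" [1000] 999)
  assumes star_star: "(x\<^sup>\<star>)\<^sup>\<star> = x"
    and star_mult: "(x * y)\<^sup>\<star> = y\<^sup>\<star> * x\<^sup>\<star>"
    and star_add: "(x + y)\<^sup>\<star> = x\<^sup>\<star> + y\<^sup>\<star>"

definition inverse_of :: "'a::monoid_mult \<Rightarrow> 'a \<Rightarrow> bool" where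
  "inverse_of x y \<longleftrightarrow> x * y = 1 \<and> y * x = 1"

definition invertible :: "'a::monoid_mult \<Rightarrow> bool" where
  "invertible x \<longleftrightarrow> (\<exists>y. inverse_of x y)"

definition the_inverse :: "'a::monoid_mult \<Rightarrow> 'a" where
  "the_inverse x = (THE y. inverse_of x y)"

definition inner_inverse_of :: "'a::semigroup_mult \<Rightarrow> 'a \<Rightarrow> bool" where
  "inner_inverse_of a x \<longleftrightarrow> a * x * a = a"

definition invertible_along :: "'a::semigroup_mult \<Rightarrow> 'a \<Rightarrow> bool" where
  "invertible_along c d \<longleftrightarrow>
     (\<exists>b. b * c * d = d \<and> d = d * c * b \<and> b \<in> range (\<lambda>r. d * r) \<inter> range (\<lambda>r. r * d))"

definition moore_penrose_invertible :: "'a::unital_star_ring \<Rightarrow> bool" where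
  "moore_penrose_invertible a \<longleftrightarrow>
     (\<exists>x. a * x * a = a \<and> x * a * x = x \<and> (a * x)\<^sup>\<star> = a * x \<and> (x * a)\<^sup>\<star> = x * a)"

definition core_inverse_of :: "'a::unital_star_ring \<Rightarrow> 'a \<Rightarrow> 'a \<Rightarrow> bool" where
  "core_inverse_of w a x \<longleftrightarrow>
     a * w * x ^ 2 = x \<and> x * a * w * a = a \<and> (a * w * x)\<^sup>\<star> = a * w * x"

definition core_invertible :: "'a::unital_star_ring \<Rightarrow> 'a \<Rightarrow> bool" where
  "core_invertible w a \<longleftrightarrow> (\<exists>x. core_inverse_of w a x)"

definition the_core_inverse :: "'a::unital_star_ring \<Rightarrow> 'a \<Rightarrow> 'a" where
  "the_core_inverse w a = (THE x. core_inverse_of w a x)"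

definition dual_core_inverse_of :: "'a::unital_star_ring \<Rightarrow> 'a \<Rightarrow> 'a \<Rightarrow> bool" where
  "dual_core_inverse_of v a y \<longleftrightarrow>
     a * v * a * y = a \<and> y ^ 2 * v * a = y \<and> (y * v * a)\<^sup>\<star> = y * v * a"

definition dual_core_invertible :: "'a::unital_star_ring \<Rightarrow> 'a \<Rightarrow> bool" where
  "dual_core_invertible v a \<longleftrightarrow> (\<exists>y. dual_core_inverse_of v a y)"

definition the_dual_core_inverse :: "'a::unital_star_ring \<Rightarrow> 'a \<Rightarrow> 'a" where
  "the_dual_core_inverse v a = (THE y. dual_core_inverse_of v a y)"

text \<open>The uniqueness facts below justify the definite descriptions.\<close>

lemma inverse_of_unique:
  assumes "inverse_of x y" and "inverse_of x z"
  shows "y = z"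
  using assms unfolding inverse_of_def by (metis mult.assoc mult_1_left mult_1_right)

lemma the_inverse_eq: "inverse_of x y \<Longrightarrow> the_inverse x = y"
  unfolding the_inverse_def by (blast intro: inverse_of_unique)

lemma core_inverse_of_unique:
  assumes x: "core_inverse_of w a x" and y: "core_inverse_of w a y"
  shows "x = y"
proof -
  have fix_a: "a * w * z * a = a" if z: "core_inverse_of w a z" for z
  proof -
    have "z * z * a * w * a = z * a" "a * w * z * z = z" "z * a * w * a = a"
      using z by (simp_all add: core_inverse_of_def power2_eq_square mult.assoc)
    then show ?thesis by (metis mult.assoc)
  qed
  have sub: "x * a * w * y = y" if "core_inverse_of w a x" "core_inverse_of w a y" for x y
    using that unfolding core_inverse_of_def by (metis mult.assoc)
  have px: "a * w * y * (a * w * x) = a * w * x"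
    using fix_a[OF y] by (simp flip: mult.assoc)
  have py: "a * w * x * (a * w * y) = a * w * y"
    using fix_a[OF x] by (simp flip: mult.assoc)
  have "a * w * x = (a * w * y * (a * w * x))\<^sup>\<star>"
    using px x by (simp add: core_inverse_of_def)
  also have "\<dots> = a * w * x * (a * w * y)"
    using x y by (simp only: star_mult[of "a * w * y"] core_inverse_of_def)
  also have "\<dots> = a * w * y" by (rule py)
  finally have eq: "a * w * x = a * w * y" .
  have "x = y * (a * w * x)" using sub[OF y x] by (simp add: mult.assoc)
  also have "\<dots> = y * (a * w * y)" by (simp only: eq)
  also have "\<dots> = y" using sub[OF y y] by (simp add: mult.assoc)
  finally show ?thesis .
qed

lemma the_core_inverse_eq: "core_inverse_of w a x \<Longrightarrow> the_core_inverse w a = x"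
  unfolding the_core_inverse_def by (blast intro: core_inverse_of_unique)

lemma dual_core_inverse_of_iff:
  "dual_core_inverse_of v a y \<longleftrightarrow> core_inverse_of (v\<^sup>\<star>) (a\<^sup>\<star>) (y\<^sup>\<star>)"
proof -
  have inj: "p\<^sup>\<star> = q\<^sup>\<star> \<longleftrightarrow> p = q" for p q :: 'a by (metis star_star)
  have "a\<^sup>\<star> * v\<^sup>\<star> * y\<^sup>\<star> ^ 2 = (y ^ 2 * v * a)\<^sup>\<star>" "y\<^sup>\<star> * a\<^sup>\<star> * v\<^sup>\<star> * a\<^sup>\<star> = (a * v * a * y)\<^sup>\<star>"
    "a\<^sup>\<star> * v\<^sup>\<star> * y\<^sup>\<star> = (y * v * a)\<^sup>\<star>"
    by (simp_all add: star_mult power2_eq_square mult.assoc)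
  then show ?thesis
    unfolding dual_core_inverse_of_def core_inverse_of_def by (auto simp: inj)
qed

lemma dual_core_inverse_of_unique:
  assumes "dual_core_inverse_of v a x" and "dual_core_inverse_of v a y"
  shows "x = y"
  using assms core_inverse_of_unique unfolding dual_core_inverse_of_iff by (metis star_star)

lemma the_dual_core_inverse_eq:
  "dual_core_inverse_of v a y \<Longrightarrow> the_dual_core_inverse v a = y"
  unfolding the_dual_core_inverse_def by (blast intro: dual_core_inverse_of_unique)

end

theory Submission
  imports Defs
begin

text \<open>
  Every condition is expressed through invertibility along \<open>a\<close>. By a theorem of Mary, an element \<open>c\<close> is
  invertible along \<open>a\<close> iff \<open>ac + 1 - aa\<^sup>-\<close> is a unit, and by Jacobson's lemma iff \<open>ca + 1 - a\<^sup>-a\<close> is one.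
  Hence (iii) and (v) say that \<open>wavaa\<^sup>\<star>\<close> is invertible along \<open>a\<close>, and (iv) and (vi) say this
  of \<open>vawaa\<^sup>\<star>\<close>. Elements invertible along \<open>a\<close> are closed under \<open>(g, h) \<mapsto> gah\<close>, with cancellation, and
  \<open>a\<^sup>\<star>\<close> is invertible along \<open>a\<close> iff \<open>a\<close> is Moore-Penrose invertible. Finally \<open>u\<^sup>-\<^sup>1awava\<close>
  is the adjoint of the Moore-Penrose inverse \<open>x\<close> of \<open>a\<close>, and the core and dual core inverses are
  \<open>bx\<close> and \<open>xb'\<close> for the inverses \<open>b\<close> and \<open>b'\<close> of \<open>w\<close> and \<open>v\<close> along \<open>a\<close>.
\<close>

section \<open>Invertibility along an element of a semigroup\<close>

text \<open>Evaluating \<open>m * d * c * d * n\<close> in two ways gives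
  \<open>d * n = m * d\<close>; this common element is the inverse of \<open>c\<close> along
  \<open>d\<close>.\<close>

lemma invertible_along_iff:
  fixes c d :: "'a::semigroup_mult"
  shows "invertible_along c d \<longleftrightarrow> (\<exists>n. d * c * d * n = d) \<and> (\<exists>m. m * d * c * d = d)"
proof
  assume "invertible_along c d"
  then obtain b p q where "b * c * d = d" "d = d * c * b" "b = d * p" "b = q * d"
    unfolding invertible_along_def by blast
  then show "(\<exists>n. d * c * d * n = d) \<and> (\<exists>m. m * d * c * d = d)"
    by (metis mult.assoc)
next
  assume "(\<exists>n. d * c * d * n = d) \<and> (\<exists>m. m * d * c * d = d)"
  then obtain n m where n: "d * c * d * n = d" and m: "m * d * c * d = d" by blast
  have eq: "d * n = m * d"
    using n m by (metis mult.assoc)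
  have "d * n * c * d = d" "d = d * c * (d * n)"
    using eq n m by (simp_all add: mult.assoc)
  then show "invertible_along c d"
    unfolding invertible_along_def using eq by blast
qed

lemma invertible_along_mult:
  fixes a g h :: "'a::semigroup_mult"
  assumes "invertible_along g a" and "invertible_along h a"
  shows "invertible_along (g * a * h) a"
proof -
  obtain n1 m1 where g: "a * g * a * n1 = a" "m1 * a * g * a = a"
    using assms(1) invertible_along_iff by blast
  obtain n2 m2 where h: "a * h * a * n2 = a" "m2 * a * h * a = a"
    using assms(2) invertible_along_iff by blast
  have "a * (g * a * h) * a * (n2 * n1) = a * g * (a * h * a * n2) * n1"
    by (simp only: mult.assoc)
  moreover have "m2 * m1 * a * (g * a * h) * a = m2 * (m1 * a * g * a) * h * a"
    by (simp only: mult.assoc)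
  ultimately show ?thesis
    unfolding invertible_along_iff using g h by metis
qed

lemma invertible_along_cancel_left:
  fixes a g h :: "'a::semigroup_mult"
  assumes "invertible_along (g * a * h) a" and "invertible_along g a"
  shows "invertible_along h a"
proof -
  obtain n m where gh: "a * (g * a * h) * a * n = a" "m * a * (g * a * h) * a = a"
    using assms(1) invertible_along_iff by blast
  obtain n1 m1 where g: "a * g * a * n1 = a" "m1 * a * g * a = a"
    using assms(2) invertible_along_iff by blast
  \<comment> \<open>The right side collapses to \<open>m1 * a\<close>, which right multiplication by
    \<open>g * a\<close> turns back into \<open>a\<close>.\<close>
  have "a * h * a * n = m1 * (a * (g * a * h) * a * n)"
    using g(2) by (metis mult.assoc)
  then have "a * h * a * n * (g * a) = a"
    using gh(1) g(2) by (simp add: mult.assoc)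
  then have "a * h * a * (n * g * a) = a"
    by (simp only: mult.assoc)
  moreover have "(m * a * g) * a * h * a = a"
    using gh(2) by (simp only: mult.assoc)
  ultimately show ?thesis
    unfolding invertible_along_iff by blast
qed

lemma invertible_along_cancel_right:
  fixes a g h :: "'a::semigroup_mult"
  assumes "invertible_along (g * a * h) a" and "invertible_along h a"
  shows "invertible_along g a"
proof -
  obtain n m where gh: "a * (g * a * h) * a * n = a" "m * a * (g * a * h) * a = a"
    using assms(1) invertible_along_iff by blast
  obtain n1 m1 where h: "a * h * a * n1 = a" "m1 * a * h * a = a"
    using assms(2) invertible_along_iff by blast
  \<comment> \<open>Dually, this is \<open>a * n1\<close>, and left multiplication by
    \<open>a * h\<close> recovers \<open>a\<close>.\<close>
  have "m * a * g * a = (m * a * (g * a * h) * a) * n1"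
    using h(1) by (metis mult.assoc)
  then have "(a * h * m) * a * g * a = a"
    using gh(2) h(1) by (metis mult.assoc)
  moreover have "a * g * a * (h * a * n) = a"
    using gh(1) by (simp only: mult.assoc)
  ultimately show ?thesis
    unfolding invertible_along_iff by blast
qed

section \<open>Jacobson's lemma and Mary's unit criterion\<close>

text \<open>Jacobson's lemma. The candidate \<open>1 - y * z * x\<close> comes from the formal
  geometric series for the inverse of \<open>1 + y * x\<close>, with \<open>z\<close> collecting the
  inner powers of \<open>x * y\<close>.\<close>

lemma invertible_one_plus_mult_swap:
  fixes x y :: "'a::{ring,monoid_mult}"
  assumes "invertible (1 + x * y)"
  shows "invertible (1 + y * x)"
proof -
  obtain z where z: "(1 + x * y) * z = 1" "z * (1 + x * y) = 1"
    using assms unfolding invertible_def inverse_of_def by blast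
  have "(1 + y * x) * (1 - y * z * x) = 1 + y * x - y * ((1 + x * y) * z) * x"
    by (simp add: algebra_simps)
  moreover have "(1 - y * z * x) * (1 + y * x) = 1 + y * x - y * (z * (1 + x * y)) * x"
    by (simp add: algebra_simps)
  ultimately have "inverse_of (1 + y * x) (1 - y * z * x)"
    using z by (simp add: inverse_of_def)
  then show ?thesis unfolding invertible_def by blast
qed

lemma invertible_unit_swap:
  fixes a a' c :: "'a::{ring,monoid_mult}"
  shows "invertible (a * c + 1 - a * a') \<longleftrightarrow> invertible (c * a + 1 - a' * a)"
proof -
  have "a * c + 1 - a * a' = 1 + a * (c - a')" "c * a + 1 - a' * a = 1 + (c - a') * a"
    by (simp_all add: algebra_simps)
  then show ?thesis by (metis invertible_one_plus_mult_swap)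
qed

lemma invertible_along_iff_unit:
  fixes a a' c :: "'a::{ring,monoid_mult}"
  assumes "inner_inverse_of a a'"
  shows "invertible_along c a \<longleftrightarrow> invertible (a * c + 1 - a * a')"
proof
  have inner: "a * a' * a = a"
    using assms by (simp add: inner_inverse_of_def)
  assume "invertible_along c a"
  then obtain b p q where b': "b * c * a = a" "a = a * c * b" and p: "b = a * p" and q: "b = q * a"
    unfolding invertible_along_def by blast
  note b = b'(1) b'(2)[symmetric]
  have ab: "a * a' * b = b" using inner p by (metis mult.assoc)
  have ba: "b * a' * a = b" using inner q by (metis mult.assoc)
  let ?u = "a * c + 1 - a * a'"
  \<comment> \<open>The split follows the idempotent \<open>a * a'\<close>: left multiplication by
    \<open>?z\<close> is \<open>b * a'\<close> on \<open>aR\<close> and \<open>1 - b * c\<close> on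
    \<open>(1 - aa')R\<close>. Each is undone by \<open>?u\<close>, since
    \<open>a * c * b = a\<close> and \<open>a * a' * b = b\<close>.\<close>
  let ?z = "b * a' + (1 - b * c) * (1 - a * a')"
  have idem: "a * a' * (a * a') = a * a'" using inner by (metis mult.assoc)
  have "?u * ?z = a * c * b * a' + b * a' - a * a' * b * a'
      + (a * c + 1 - a * a' - a * c * b * c - b * c + a * a' * b * c) * (1 - a * a')"
    by (simp add: algebra_simps)
  also have "\<dots> = 1"
    unfolding b ab by (simp add: algebra_simps idem[unfolded mult.assoc])
  finally have 1: "?u * ?z = 1" .
  have "?z * ?u = b * a' * a * c + b * a' - b * a' * a * a'
      + (1 - b * c) * (a * c + 1 - a * a' - a * a' * a * c - a * a' + a * a' * (a * a'))"
    by (simp add: algebra_simps)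
  also have "\<dots> = b * c + (1 - b * c) - (a - b * c * a) * a'"
    unfolding ba inner idem by (simp add: algebra_simps)
  also have "\<dots> = 1"
    unfolding b by simp
  finally have "?z * ?u = 1" .
  with 1 show "invertible ?u"
    unfolding invertible_def inverse_of_def by blast
next
  have inner: "a * a' * a = a" "a * (a' * a) = a"
    using assms by (simp_all add: inner_inverse_of_def mult.assoc)
  assume u: "invertible (a * c + 1 - a * a')"
  then obtain z where z: "z * (a * c + 1 - a * a') = 1"
    unfolding invertible_def inverse_of_def by blast
  obtain y where y: "(c * a + 1 - a' * a) * y = 1"
    using u invertible_unit_swap[of a c a'] unfolding invertible_def inverse_of_def by blast
  \<comment> \<open>Both units carry \<open>a\<close> to \<open>a * c * a\<close>, one from each
    side, so their one-sided inverses are the two witnesses.\<close>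
  have "(a * c + 1 - a * a') * a = a * c * a" "a * (c * a + 1 - a' * a) = a * c * a"
    using inner by (simp_all add: algebra_simps)
  then have "a * c * a * y = a" "z * a * c * a = a"
    using y z by (metis mult.assoc mult_1_left mult_1_right)+
  then show "invertible_along c a"
    unfolding invertible_along_iff by blast
qed

section \<open>Moore-Penrose inverses and invertibility of the adjoint\<close>

definition moore_penrose_inverse_of :: "'a::unital_star_ring \<Rightarrow> 'a \<Rightarrow> bool" where
  "moore_penrose_inverse_of a x \<longleftrightarrow>
     a * x * a = a \<and> x * a * x = x \<and> (a * x)\<^sup>\<star> = a * x \<and> (x * a)\<^sup>\<star> = x * a"

lemma moore_penrose_invertible_alt:
  "moore_penrose_invertible a \<longleftrightarrow> (\<exists>x. moore_penrose_inverse_of a x)"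
  by (simp add: moore_penrose_invertible_def moore_penrose_inverse_of_def)

text \<open>The product \<open>z * a * y\<close> keeps the projection \<open>a * y\<close> on one
  side and \<open>z * a\<close> on the other.\<close>

lemma moore_penrose_inverse_of_product:
  assumes y: "a * y * a = a" "(a * y)\<^sup>\<star> = a * y"
    and z: "a * z * a = a" "(z * a)\<^sup>\<star> = z * a"
  shows "moore_penrose_inverse_of a (z * a * y)"
proof -
  have "a * (z * a * y) = a * y" "z * a * y * a = z * a"
    using y(1) z(1) by (metis mult.assoc)+
  then show ?thesis
    unfolding moore_penrose_inverse_of_def using y z by (metis mult.assoc)
qed

text \<open>Since \<open>a\<^sup>\<star> * a * x = a\<^sup>\<star> = x * a *
  a\<^sup>\<star>\<close>, the elements \<open>x * x\<^sup>\<star>\<close> and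
  \<open>x\<^sup>\<star> * x\<close> are a right and a left witness.\<close>

lemma star_invertible_along_of_moore_penrose:
  assumes "moore_penrose_invertible a"
  shows "invertible_along (a\<^sup>\<star>) a"
proof -
  obtain x where x: "a * x * a = a" "x * a * x = x" "(a * x)\<^sup>\<star> = a * x" "(x * a)\<^sup>\<star> = x * a"
    using assms unfolding moore_penrose_invertible_def by blast
  have "a\<^sup>\<star> * a * x = a\<^sup>\<star>" "x * a * a\<^sup>\<star> = a\<^sup>\<star>"
    using x by (metis star_mult mult.assoc)+
  then have "a * a\<^sup>\<star> * a * (x * x\<^sup>\<star>) = a * (x * a)\<^sup>\<star>" "(x\<^sup>\<star> * x) * a * a\<^sup>\<star> * a = (a * x)\<^sup>\<star> * a"
    by (metis star_mult mult.assoc)+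
  then have "a * a\<^sup>\<star> * a * (x * x\<^sup>\<star>) = a" "(x\<^sup>\<star> * x) * a * a\<^sup>\<star> * a = a"
    using x by (simp_all add: mult.assoc)
  then show ?thesis
    unfolding invertible_along_iff by blast
qed

lemma moore_penrose_of_left_multiple:
  fixes a m :: "'a::unital_star_ring"
  assumes m: "m * a * a\<^sup>\<star> * a = a"
  shows "moore_penrose_invertible a"
proof -
  define y where "y = (m * a)\<^sup>\<star>"
  have ystar: "y\<^sup>\<star> * a\<^sup>\<star> * a = a"
    using m by (simp add: y_def star_star)
  \<comment> \<open>Being of the form \<open>p\<^sup>\<star> * p\<close>, the element
    \<open>a * y\<close> is self-adjoint.\<close>
  have "(a * y)\<^sup>\<star> * (a * y) = a * y"
    using ystar by (metis star_mult mult.assoc)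
  then have y1: "(a * y)\<^sup>\<star> = a * y"
    by (metis star_mult star_star)
  then have y2: "a * y * a = a"
    using ystar by (metis star_mult)
  \<comment> \<open>As \<open>y = a\<^sup>\<star> * m\<^sup>\<star>\<close>, the equation
    \<open>a * y * a = a\<close> becomes the mirror image of the hypothesis, so
    \<open>q\<^sup>\<star>\<close> can supply the other projection.\<close>
  define q where "q = m\<^sup>\<star> * a"
  have q: "a * a\<^sup>\<star> * q = a"
    using y2 by (simp add: y_def q_def star_mult mult.assoc)
  then have "q\<^sup>\<star> * a * a\<^sup>\<star> = a\<^sup>\<star>"
    by (metis star_mult star_star mult.assoc)
  \<comment> \<open>Both sides equal
    \<open>q\<^sup>\<star> * a * a\<^sup>\<star> * q\<close>.\<close>
  then have "q\<^sup>\<star> * a = a\<^sup>\<star> * q"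
    using q by (metis mult.assoc)
  then have "(q\<^sup>\<star> * a)\<^sup>\<star> = q\<^sup>\<star> * a" "a * q\<^sup>\<star> * a = a"
    using q by (metis star_mult star_star, metis mult.assoc)
  then show ?thesis
    using moore_penrose_inverse_of_product[OF y2 y1] moore_penrose_invertible_alt by blast
qed

text \<open>Moore-Penrose invertibility is extracted first, from the left witness; it then permits
  cancelling \<open>a\<^sup>\<star>\<close>.\<close>

lemma mult_star_invertible_along_iff:
  fixes a g :: "'a::unital_star_ring"
  shows "invertible_along (g * a * a\<^sup>\<star>) a \<longleftrightarrow> invertible_along g a \<and> moore_penrose_invertible a"
proof
  assume ga: "invertible_along (g * a * a\<^sup>\<star>) a"
  then obtain m where "m * a * (g * a * a\<^sup>\<star>) * a = a"
    using invertible_along_iff by blast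
  then have "(m * a * g) * a * a\<^sup>\<star> * a = a"
    by (simp only: mult.assoc)
  then have "moore_penrose_invertible a"
    by (rule moore_penrose_of_left_multiple)
  then show "invertible_along g a \<and> moore_penrose_invertible a"
    using ga invertible_along_cancel_right star_invertible_along_of_moore_penrose by blast
qed (use invertible_along_mult star_invertible_along_of_moore_penrose in blast)

section \<open>Core and dual core inverses\<close>

text \<open>With \<open>a * n\<close> the inverse of \<open>w\<close> along \<open>a\<close>, the
  product \<open>a * w * (a * n * x)\<close> is the projection \<open>a * x\<close>. Leaving
  \<open>n\<close> arbitrary allows it to be built from a unit later.\<close>

lemma core_inverse_of_along_mult:
  assumes x: "moore_penrose_inverse_of a x"
    and n: "a * w * a * n = a" and m: "m * a * w * a = a"
  shows "core_inverse_of w a (a * n * x)"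
proof -
  have an: "a * n = m * a"
    using n m by (metis mult.assoc)
  have ax: "a * x * a = a" "(a * x)\<^sup>\<star> = a * x"
    using x by (simp_all add: moore_penrose_inverse_of_def)
  have awx: "a * w * (a * n * x) = a * x"
    using n by (metis mult.assoc)
  have "a * w * (a * n * x)\<^sup>2 = a * w * (a * n * x) * (a * n * x)"
    by (simp only: power2_eq_square mult.assoc)
  also have "\<dots> = a * x * a * n * x"
    unfolding awx by (simp only: mult.assoc)
  finally have "a * w * (a * n * x)\<^sup>2 = a * x * a * n * x" .
  moreover have "a * n * x * a * w * a = m * (a * x * a) * w * a"
    unfolding an by (simp only: mult.assoc)
  ultimately show ?thesis
    unfolding core_inverse_of_def awx using ax m by simp
qed

lemma dual_core_inverse_of_mult_along:
  assumes x: "moore_penrose_inverse_of a x"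
    and n: "a * v * a * n = a" and m: "m * a * v * a = a"
  shows "dual_core_inverse_of v a (x * a * n)"
proof -
  have an: "a * n = m * a"
    using n m by (metis mult.assoc)
  have ax: "a * x * a = a" "(x * a)\<^sup>\<star> = x * a"
    using x by (simp_all add: moore_penrose_inverse_of_def)
  have yva: "x * a * n * v * a = x * a"
    using an m by (metis mult.assoc)
  have "(x * a * n)\<^sup>2 * v * a = x * a * n * (x * a)"
    using yva by (metis power2_eq_square mult.assoc)
  also have "\<dots> = x * m * (a * x * a)"
    using an by (metis mult.assoc)
  also have "\<dots> = x * a * n"
    unfolding ax using an by (metis mult.assoc)
  finally have "(x * a * n)\<^sup>2 * v * a = x * a * n" .
  moreover have "a * v * a * (x * a * n) = a * v * (a * x * a) * n"
    by (simp only: mult.assoc)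
  ultimately show ?thesis
    unfolding dual_core_inverse_of_def yva using ax n by simp
qed

text \<open>If \<open>x\<close> is the core inverse, \<open>y = w * x\<close> gives the left half of
  the Moore-Penrose data; the dual core inverse gives the right half.\<close>

lemma core_invertible_imp:
  assumes "core_invertible w a"
  obtains y where "invertible_along w a" "a * y * a = a" "(a * y)\<^sup>\<star> = a * y"
proof -
  obtain x where x: "a * w * (x * x) = x" "x * a * w * a = a" "(a * w * x)\<^sup>\<star> = a * w * x"
    using assms unfolding core_invertible_def core_inverse_of_def power2_eq_square by blast
  \<comment> \<open>Replace the last \<open>a\<close> by \<open>x * a * w * a\<close> and collapse
    \<open>a * w * x * x\<close> to \<open>x\<close>.\<close>
  have awxa: "a * w * x * a = a"
    using x(1,2) by (metis mult.assoc)
  then have "a * w * a * (w * x * x * a) = a"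
    using x(1) by (metis mult.assoc)
  then have "invertible_along w a"
    unfolding invertible_along_iff using x(2) by blast
  then show thesis
    using that[of "w * x"] awxa x(3) by (simp add: mult.assoc)
qed

lemma dual_core_invertible_imp:
  assumes "dual_core_invertible v a"
  obtains z where "a * z * a = a" "(z * a)\<^sup>\<star> = z * a"
proof -
  obtain y where y: "a * v * a * y = a" "y * y * v * a = y" "(y * v * a)\<^sup>\<star> = y * v * a"
    using assms unfolding dual_core_invertible_def dual_core_inverse_of_def power2_eq_square by blast
  have "a * (y * v) * a = a"
    using y(1,2) by (metis mult.assoc)
  then show thesis
    using that y(3) by blast
qed

lemma core_and_dual_core_invertible_iff:
  assumes "invertible_along v a"
  shows "core_invertible w a \<and> dual_core_invertible v a \<longleftrightarrow>
    invertible_along w a \<and> moore_penrose_invertible a"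
proof
  assume "core_invertible w a \<and> dual_core_invertible v a"
  then show "invertible_along w a \<and> moore_penrose_invertible a"
    by (metis core_invertible_imp dual_core_invertible_imp moore_penrose_inverse_of_product
        moore_penrose_invertible_alt)
next
  assume "invertible_along w a \<and> moore_penrose_invertible a"
  then show "core_invertible w a \<and> dual_core_invertible v a"
    using assms unfolding invertible_along_iff moore_penrose_invertible_alt
      core_invertible_def dual_core_invertible_def
    by (blast intro: core_inverse_of_along_mult dual_core_inverse_of_mult_along)
qed

section \<open>Explicit formulas and the equivalences\<close>

lemma the_inverse:
  assumes "invertible x"
  shows "x * the_inverse x = 1" and "the_inverse x * x = 1"
  using assms the_inverse_eq unfolding invertible_def inverse_of_def by blast+

lemma along_unit_right_factor:
  fixes a a' c s :: "'a::{ring,monoid_mult}"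
  assumes "inner_inverse_of a a'" and s: "s = c * a + 1 - a' * a" and "invertible s"
  shows "a * c * a * the_inverse s = a"
proof -
  have "a * (a' * a) = a"
    using assms(1) by (simp add: inner_inverse_of_def mult.assoc)
  then have "a * s = a * c * a"
    unfolding s by (simp add: algebra_simps)
  then show ?thesis
    using the_inverse(1)[OF assms(3)] by (metis mult.assoc mult_1_right)
qed

text \<open>Applying \<open>u\<close> to \<open>x\<^sup>\<star>\<close> gives
  \<open>a * g * a\<close>: \<open>x\<^sup>\<star>\<close> lies in \<open>aR\<close>, so the part
  \<open>1 - a * a'\<close> kills it, while
  \<open>a * a\<^sup>\<star> * x\<^sup>\<star> = a\<close>.\<close>

lemma moore_penrose_inverse_from_unit:
  fixes a a' g u x :: "'a::unital_star_ring"
  assumes x: "moore_penrose_inverse_of a x" and "inner_inverse_of a a'"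
    and u: "u = a * g * a * a\<^sup>\<star> + 1 - a * a'" and "invertible u"
  shows "(the_inverse u * a * g * a)\<^sup>\<star> = x"
proof -
  have xs: "a * x * a = a" "x * a * x = x" "(a * x)\<^sup>\<star> = a * x" "(x * a)\<^sup>\<star> = x * a"
    using x by (simp_all add: moore_penrose_inverse_of_def)
  have inner: "a * a' * a = a"
    using assms(2) by (simp add: inner_inverse_of_def)
  have "x\<^sup>\<star> = a * x * x\<^sup>\<star>"
    using xs by (metis star_mult mult.assoc)
  then have 1: "a * a' * x\<^sup>\<star> = x\<^sup>\<star>"
    using inner by (metis mult.assoc)
  have 2: "a * a\<^sup>\<star> * x\<^sup>\<star> = a"
    using xs by (metis star_mult mult.assoc)
  have "u * x\<^sup>\<star> = a * g * (a * a\<^sup>\<star> * x\<^sup>\<star>) + x\<^sup>\<star> - a * a' * x\<^sup>\<star>"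
    unfolding u by (simp add: algebra_simps)
  also have "\<dots> = a * g * a"
    unfolding 1 2 by simp
  finally have "the_inverse u * a * g * a = x\<^sup>\<star>"
    using the_inverse(2)[OF assms(4)] by (metis mult.assoc mult_1_left)
  then show ?thesis by (simp add: star_star)
qed

theorem theorem3p5:
  fixes a w v a' u r s t :: "'a::unital_star_ring"
  assumes "invertible_along v a"
    and "inner_inverse_of a a'"
    and "u = a * w * a * v * a * a\<^sup>\<star> + 1 - a * a'"
    and "r = a * v * a * w * a * a\<^sup>\<star> + 1 - a * a'"
    and "s = w * a * v * a * a\<^sup>\<star> * a + 1 - a' * a"
    and "t = v * a * w * a * a\<^sup>\<star> * a + 1 - a' * a"
  shows "((core_invertible w a \<and> dual_core_invertible v a) \<longleftrightarrow>
            (invertible_along w a \<and> moore_penrose_invertible a)) \<and>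
         ((core_invertible w a \<and> dual_core_invertible v a) \<longleftrightarrow> invertible u) \<and>
         ((core_invertible w a \<and> dual_core_invertible v a) \<longleftrightarrow> invertible r) \<and>
         ((core_invertible w a \<and> dual_core_invertible v a) \<longleftrightarrow> invertible s) \<and>
         ((core_invertible w a \<and> dual_core_invertible v a) \<longleftrightarrow> invertible t) \<and>
         (core_invertible w a \<and> dual_core_invertible v a \<longrightarrow>
            the_core_inverse w a =
              a * v * a * a\<^sup>\<star> * a * the_inverse s * (the_inverse u * a * w * a * v * a)\<^sup>\<star> \<and>
            the_dual_core_inverse v a =
              (the_inverse u * a * w * a * v * a)\<^sup>\<star> * a * w * a * a\<^sup>\<star> * a * the_inverse t)"
proof -
  note v = assms(1) and inner = assms(2)
  let ?i = "core_invertible w a \<and> dual_core_invertible v a"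
  let ?ii = "invertible_along w a \<and> moore_penrose_invertible a"
  let ?c = "w * a * v * a * a\<^sup>\<star>"
  let ?d = "v * a * w * a * a\<^sup>\<star>"
  have u: "u = a * ?c + 1 - a * a'" and r: "r = a * ?d + 1 - a * a'"
    unfolding assms(3,4) by (simp_all only: mult.assoc)
  have i_ii: "?i \<longleftrightarrow> ?ii"
    using core_and_dual_core_invertible_iff[OF v] .
  \<comment> \<open>Here \<open>g\<close> is \<open>w * a * v\<close>, and \<open>v\<close> is
    cancelled on the right; for \<open>?d\<close> it is cancelled on the left.\<close>
  have c: "?ii \<longleftrightarrow> invertible_along ?c a"
    unfolding mult_star_invertible_along_iff
    using v invertible_along_mult invertible_along_cancel_right by blast
  have d: "?ii \<longleftrightarrow> invertible_along ?d a"
    unfolding mult_star_invertible_along_iff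
    using v invertible_along_mult invertible_along_cancel_left by blast
  have iii: "?i \<longleftrightarrow> invertible u"
    unfolding u using i_ii c invertible_along_iff_unit[OF inner] by blast
  have iv: "?i \<longleftrightarrow> invertible r"
    unfolding r using i_ii d invertible_along_iff_unit[OF inner] by blast
  have v_s: "?i \<longleftrightarrow> invertible s"
    unfolding iii u assms(5) by (rule invertible_unit_swap)
  have vi: "?i \<longleftrightarrow> invertible t"
    unfolding iv r assms(6) by (rule invertible_unit_swap)
  let ?x = "(the_inverse u * a * w * a * v * a)\<^sup>\<star>"
  have "the_core_inverse w a = a * v * a * a\<^sup>\<star> * a * the_inverse s * ?x \<and>
      the_dual_core_inverse v a = ?x * a * w * a * a\<^sup>\<star> * a * the_inverse t" if i: ?i
  proof -
    obtain x where x: "moore_penrose_inverse_of a x"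
      using i i_ii moore_penrose_invertible_alt by blast
    have "u = a * (w * a * v) * a * a\<^sup>\<star> + 1 - a * a'"
      unfolding u by (simp only: mult.assoc)
    from moore_penrose_inverse_from_unit[OF x inner this] have xeq: "?x = x"
      using i iii by (simp add: mult.assoc)
    obtain m where m: "m * a * w * a = a"
      using i i_ii invertible_along_iff by blast
    obtain k where k: "k * a * v * a = a"
      using v invertible_along_iff by blast
    \<comment> \<open>The unit \<open>s\<close> yields an explicit right witness \<open>n\<close>
      for \<open>w\<close>, so \<open>a * n * x\<close> is the claimed formula; \<open>t\<close>
      does the same for \<open>v\<close>.\<close>
    have "a * w * a * (v * a * a\<^sup>\<star> * a * the_inverse s) = a"
      using along_unit_right_factor[OF inner assms(5)] i v_s by (simp add: mult.assoc)
    from the_core_inverse_eq[OF core_inverse_of_along_mult[OF x this m]]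
    have core: "the_core_inverse w a = a * v * a * a\<^sup>\<star> * a * the_inverse s * x"
      by (simp only: mult.assoc)
    have "a * v * a * (w * a * a\<^sup>\<star> * a * the_inverse t) = a"
      using along_unit_right_factor[OF inner assms(6)] i vi by (simp add: mult.assoc)
    from the_dual_core_inverse_eq[OF dual_core_inverse_of_mult_along[OF x this k]]
    have "the_dual_core_inverse v a = x * a * w * a * a\<^sup>\<star> * a * the_inverse t"
      by (simp only: mult.assoc)
    with core show ?thesis unfolding xeq by simp
  qed
  then show ?thesis
    using i_ii iii iv v_s vi by blast
qed

end
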